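(* For every integer $n\geq 0$ and every $p\in(0,1)$ the limit $$\lim_{x\to 0^+}u_p^{(n)}(x)$$ exists in $\mathbb R$, and its value is independent of $p$.
   Context: For $p\in(0,1)$ and $x>0$, $m_p(x)>0$ denotes the $p$-quantile of the gamma distribution with shape parameter $x$ and scale parameter $1$, i.e. the unique positive number with $\int_0^{m_p(x)}e^{-t}t^{x-1}\,dt=p\,\Gamma(x)$. (The function $m_p$ is $C^\infty$ on $(0,\infty)$.) Define $u_p(x)=e^{-\frac{\log p}{x}}m_p(x)$ for $x>0$; $u_p^{(n)}$ is its $n$-th derivative on $(0,\infty)$. *)

theory Defs
  imports "HOL-Analysis.Analysis"
begin

text \<open>The quantile is only meaningful for \<open>0 < p < 1\<close> and \<open>x > 0\<close>; there the integrand is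
  absolutely integrable, and the value \<open>0 powr (x - 1) = 0\<close> at the left end point does not
  affect the integral.\<close>

definition gamma_quantile :: "real \<Rightarrow> real \<Rightarrow> real" where
  "gamma_quantile p x =
     (THE m. m > 0 \<and> integral {0..m} (\<lambda>t. exp (- t) * t powr (x - 1)) = p * Gamma x)"

definition scaled_quantile :: "real \<Rightarrow> real \<Rightarrow> real" where
  "scaled_quantile p x = exp (- (ln p / x)) * gamma_quantile p x"

end

theory Submission
  imports Defs "HOL-Complex_Analysis.Complex_Analysis" "HOL-Real_Asymp.Real_Asymp"
begin

text \<open>Write \<open>m\<close> for the \<open>p\<close>-quantile at \<open>x\<close>. Expanding \<open>exp (- t)\<close> under the integral turns the equation for
  \<open>m\<close> into \<open>m powr x * (1 + x * H x m) = p * Gamma (1 + x)\<close>, where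
  \<open>H x m = (\<Sum>k\<ge>1. (- m) ^ k / (fact k * (x + k)))\<close> vanishes at \<open>m = 0\<close>; this is \<open>gamma_tail\<close>. Taking logarithms
  and dividing by \<open>x\<close>, the scaled quantile \<open>u\<close> satisfies
  \<open>ln u = \<phi> x - ln (1 + x * H x m) / x\<close> with \<open>\<phi> x = ln_Gamma (1 + x) / x\<close>. The function \<open>\<phi>\<close> is holomorphic
  at \<open>0\<close> because \<open>ln_Gamma 1 = 0\<close>, and it does not involve \<open>p\<close>. The remaining term is of the size of
  \<open>m = p powr (1 / x) * u\<close>, hence smaller than every power of \<open>x\<close>. So \<open>u\<close> should have the same
  limits of derivatives as \<open>exp \<circ> \<phi>\<close>, and the \<open>n\<close>-th limit is the \<open>n\<close>-th derivative of \<open>exp \<circ> \<phi>\<close> at \<open>0\<close>.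
  
  The bound on the remainder passes to its derivatives by working over the complex numbers. On a
  sector around the positive axis \<open>exp (ln p / z)\<close> is still exponentially small, and the
  equation for \<open>r = ln u - \<phi>\<close> reads \<open>r = - ln (1 + z * H z m) / z\<close> with
  \<open>m = exp (ln p / z + \<phi> z) * exp r\<close>. Near the vertex the right-hand side is a contraction in \<open>r\<close>, uniformly in \<open>z\<close>,
  so \<open>r\<close> exists and is holomorphic as a uniform limit of iterates (\<open>holomorphic_fixed_point\<close>). It is
  real on the positive axis, where monotonicity of the incomplete gamma function identifies the resulting \<open>m\<close>
  with the quantile (\<open>scaled_quantile_holomorphic_extension\<close>). Since a disc of radius
  proportional to \<open>x\<close> around \<open>x\<close> fits into the sector, Cauchy's inequality costs
  only a power of \<open>x\<close> per derivative, which the exponential absorbs (\<open>higher_deriv_flat_on_sector\<close>).\<close>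

section \<open>The lower incomplete gamma function near shape parameter zero\<close>

text \<open>The lower incomplete gamma function is \<open>m powr x * (1 / x + gamma_tail x m)\<close>. Splitting off the
  singular term \<open>1 / x\<close> leaves a series that stays bounded as \<open>x\<close> tends to \<open>0\<close>. The definition is
  polymorphic because the integral needs it over the reals and the contraction argument over the complex numbers.\<close>
definition gamma_tail :: "'a::{real_normed_field,banach} \<Rightarrow> 'a \<Rightarrow> 'a" where
  "gamma_tail x m = (\<Sum>k. (- m) ^ Suc k / (fact (Suc k) * (x + of_nat (Suc k))))"

lemma fact_Suc_ge_power2: "2 ^ k \<le> (fact (Suc k) :: real)"
proof (induction k)
  case (Suc k)
  have "2 ^ Suc k = 2 * (2 ^ k :: real)" by simp
  also have "\<dots> \<le> real (Suc (Suc k)) * fact (Suc k)"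
    using Suc by (intro mult_mono) auto
  finally show ?case by (simp only: fact_Suc[of "Suc k"] of_nat_mult of_nat_fact)
qed simp

text \<open>The factor \<open>Suc k\<close> lost in \<open>m ^ Suc k - m' ^ Suc k\<close> is regained from \<open>Re (x + Suc k) \<ge> Suc k\<close>, which
  is why the bound does not depend on \<open>x\<close>, however close to \<open>0\<close>.\<close>
lemma gamma_tail_term_lipschitz:
  fixes x m m' :: complex
  assumes "Re x > 0" "norm m \<le> 1" "norm m' \<le> 1"
  shows "norm ((- m) ^ Suc k / (fact (Suc k) * (x + of_nat (Suc k))) -
               (- m') ^ Suc k / (fact (Suc k) * (x + of_nat (Suc k)))) \<le> norm (m - m') * (1/2) ^ k"
proof -
  have "real (Suc k) \<le> Re (x + of_nat (Suc k))" using assms(1) by simp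
  also have "\<dots> \<le> norm (x + of_nat (Suc k))" by (rule complex_Re_le_cmod)
  finally have den: "real (Suc k) \<le> norm (x + of_nat (Suc k))" .
  have num: "norm ((- m) ^ Suc k - (- m') ^ Suc k) \<le> real (Suc k) * norm (m - m')"
    using norm_power_diff[of "- m" "- m'" "Suc k"] assms by (simp add: norm_minus_commute)
  have "norm ((- m) ^ Suc k / (fact (Suc k) * (x + of_nat (Suc k))) -
               (- m') ^ Suc k / (fact (Suc k) * (x + of_nat (Suc k))))
      = norm ((- m) ^ Suc k - (- m') ^ Suc k) / (fact (Suc k) * norm (x + of_nat (Suc k)))"
    by (simp only: diff_divide_distrib[symmetric] norm_divide norm_mult norm_fact)
  also have "\<dots> \<le> (real (Suc k) * norm (m - m')) / (2 ^ k * real (Suc k))"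
    using fact_Suc_ge_power2[of k] den num by (intro frac_le mult_mono) auto
  also have "\<dots> = norm (m - m') * (1/2) ^ k"
    by (simp add: field_simps power_divide del: of_nat_Suc)
  finally show ?thesis .
qed

lemma gamma_tail_term_bound:
  fixes x m :: complex
  assumes "Re x > 0" "norm m \<le> 1"
  shows "norm ((- m) ^ Suc k / (fact (Suc k) * (x + of_nat (Suc k)))) \<le> norm m * (1/2) ^ k"
  using gamma_tail_term_lipschitz[OF assms, of 0 k] by simp

lemma gamma_tail_lipschitz:
  fixes x m m' :: complex
  assumes "Re x > 0" "norm m \<le> 1" "norm m' \<le> 1"
  shows "norm (gamma_tail x m - gamma_tail x m') \<le> 2 * norm (m - m')"
proof -
  have g: "summable (\<lambda>k. c * (1/2) ^ k)" for c :: real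
    by (intro summable_mult summable_geometric) auto
  have s: "summable (\<lambda>k. (- w) ^ Suc k / (fact (Suc k) * (x + of_nat (Suc k))))"
    if "norm w \<le> 1" for w
    using gamma_tail_term_bound[OF assms(1) that]
    by (intro summable_comparison_test'[OF g[of "norm w"], of 0]) auto
  have "gamma_tail x m - gamma_tail x m' =
     (\<Sum>k. (- m) ^ Suc k / (fact (Suc k) * (x + of_nat (Suc k))) -
               (- m') ^ Suc k / (fact (Suc k) * (x + of_nat (Suc k))))"
    unfolding gamma_tail_def by (rule suminf_diff[OF s[OF assms(2)] s[OF assms(3)]])
  also have "norm \<dots> \<le> (\<Sum>k. norm (m - m') * (1/2) ^ k)"
    by (rule norm_suminf_le[OF gamma_tail_term_lipschitz[OF assms] g])
  also have "\<dots> = 2 * norm (m - m')"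
    by (subst suminf_mult) (auto simp: suminf_geometric)
  finally show ?thesis .
qed

lemma gamma_tail_0 [simp]: "gamma_tail x 0 = 0"
  by (simp add: gamma_tail_def)

lemma holomorphic_gamma_tail:
  assumes "open S" "\<And>x. x \<in> S \<Longrightarrow> Re x > 0"
    and "m holomorphic_on S" "\<And>x. x \<in> S \<Longrightarrow> norm (m x) \<le> 1"
  shows "(\<lambda>x. gamma_tail x (m x)) holomorphic_on S"
  unfolding gamma_tail_def
proof (rule holomorphic_uniform_sequence[OF assms(1)])
  show "(\<lambda>x. \<Sum>k<n. (- m x) ^ Suc k / (fact (Suc k) * (x + of_nat (Suc k)))) holomorphic_on S"
    for n
  proof (intro holomorphic_intros assms)
    show "fact (Suc k) * (x + of_nat (Suc k)) \<noteq> 0" if "x \<in> S" for k x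
      using assms(2)[OF that] by (auto simp: complex_eq_iff simp del: of_nat_Suc)
  qed
  have "uniform_limit S (\<lambda>n x. \<Sum>k<n. (- m x) ^ Suc k / (fact (Suc k) * (x + of_nat (Suc k))))
     (\<lambda>x. \<Sum>k. (- m x) ^ Suc k / (fact (Suc k) * (x + of_nat (Suc k)))) sequentially"
  proof (rule Weierstrass_m_test[where M = "\<lambda>k. (1/2) ^ k"])
    show "norm ((- m x) ^ Suc k / (fact (Suc k) * (x + of_nat (Suc k)))) \<le> (1/2) ^ k"
      if "x \<in> S" for k x
      by (rule order_trans[OF gamma_tail_term_bound])
         (use assms(2,4)[OF that] in \<open>auto intro!: mult_left_le_one_le\<close>)
  qed auto
  then show "\<exists>d>0. cball x d \<subseteq> S \<and> uniform_limit (cball x d)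
      (\<lambda>n x. \<Sum>k<n. (- m x) ^ Suc k / (fact (Suc k) * (x + of_nat (Suc k))))
      (\<lambda>x. \<Sum>k. (- m x) ^ Suc k / (fact (Suc k) * (x + of_nat (Suc k)))) sequentially"
    if "x \<in> S" for x
    using open_contains_cball_eq[OF assms(1)] that by (meson uniform_limit_on_subset)
qed

lemma summable_gamma_tail_real:
  fixes x m :: real
  assumes "x > 0"
  shows "summable (\<lambda>k. (-1) ^ k / (fact k * (x + of_nat k)) * m ^ k)"
proof (rule summable_comparison_test')
  show "summable (\<lambda>k. norm m ^ k /\<^sub>R fact k * (1 / x))"
    by (intro summable_mult2 summable_exp_generic)
  show "norm ((-1) ^ k / (fact k * (x + of_nat k)) * m ^ k) \<le> norm m ^ k /\<^sub>R fact k * (1 / x)"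
    if "k \<ge> 0" for k
  proof -
    have "norm ((-1) ^ k / (fact k * (x + of_nat k)) * m ^ k) =
      norm m ^ k / fact k * (1 / (x + real k))"
      using assms by (simp add: abs_mult power_abs)
    also have "\<dots> \<le> norm m ^ k / fact k * (1 / x)"
      using assms by (intro mult_left_mono divide_left_mono) auto
    finally show ?thesis by (simp add: divide_inverse mult.commute)
  qed
qed

lemma gamma_tail_of_real:
  fixes x m :: real
  assumes "x > 0"
  shows "gamma_tail (complex_of_real x) (of_real m) = of_real (gamma_tail x m)"
proof -
  have eq: "(-1) ^ k / (fact k * (x + of_nat k)) * m ^ k = (- m) ^ k / (fact k * (x + of_nat k))"
    for k by (simp add: power_minus[of m])
  have "summable (\<lambda>k. (- m) ^ Suc k / (fact (Suc k) * (x + of_nat (Suc k))))"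
    using summable_gamma_tail_real[OF assms, of m] unfolding eq
    by (subst summable_Suc_iff[where f = "\<lambda>k. (- m) ^ k / (fact k * (x + of_nat k))"])
  from suminf_of_real[OF this, where 'a = complex, symmetric]
  show ?thesis by (simp add: gamma_tail_def)
qed

lemma gamma_tail_series:
  fixes x m :: real
  assumes "x > 0"
  shows "1 / x + gamma_tail x m = (\<Sum>k. (-1) ^ k / (fact k * (x + of_nat k)) * m ^ k)"
proof -
  have eq: "(-1) ^ k / (fact k * (x + of_nat k)) * m ^ k = (- m) ^ k / (fact k * (x + of_nat k))"
    for k by (simp add: power_minus[of m])
  show ?thesis
    using suminf_split_head[OF summable_gamma_tail_real[OF assms, of m]]
    unfolding gamma_tail_def eq by simp
qed

text \<open>The power series \<open>E m = 1 / x + gamma_tail x m\<close> has coefficients \<open>(-1) ^ k / (fact k * (x + k))\<close>, and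
  the operator \<open>x * E + m * E'\<close> multiplies the \<open>k\<close>-th one by \<open>x + k\<close>, so it produces \<open>exp (- m)\<close>. This is
  the derivative of \<open>m powr x * E m\<close> divided by \<open>m powr (x - 1)\<close>.\<close>
lemma DERIV_incomplete_gamma:
  fixes x m :: real
  assumes "x > 0" "m > 0"
  shows "((\<lambda>m. m powr x * (1 / x + gamma_tail x m)) has_real_derivative
           exp (- m) * m powr (x - 1)) (at m)"
proof -
  define c where "c k = (-1) ^ k / (fact k * (x + of_nat k))" for k
  have cs: "summable (\<lambda>k. c k * y ^ k)" for y
    unfolding c_def by (rule summable_gamma_tail_real[OF assms(1)])
  have E: "(\<lambda>m. 1 / x + gamma_tail x m) = (\<lambda>m. \<Sum>k. c k * m ^ k)"
    using gamma_tail_series[OF assms(1)] by (simp add: c_def fun_eq_iff)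
  define D where "D = (\<Sum>k. diffs c k * m ^ k)"
  have d: "((\<lambda>m. 1 / x + gamma_tail x m) has_real_derivative D) (at m)"
    unfolding E D_def by (rule termdiffs_strong_converges_everywhere[OF cs])
  have ds: "summable (\<lambda>k. diffs c k * m ^ k)"
    by (rule termdiff_converges_all[OF cs])
  have "(\<lambda>k. of_nat k * c k * m ^ (k - Suc 0)) sums D"
    unfolding D_def by (rule diffs_equiv[OF ds])
  from sums_mult[OF this, of m] have mD: "(\<lambda>k. of_nat k * c k * m ^ k) sums (m * D)"
  proof (rule sums_cong[THEN iffD1, rotated])
    show "m * (of_nat k * c k * m ^ (k - Suc 0)) = of_nat k * c k * m ^ k" for k
      by (cases k) auto
  qed
  have xE: "(\<lambda>k. x * (c k * m ^ k)) sums (x * (1 / x + gamma_tail x m))"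
    using summable_sums[OF cs[of m]] fun_cong[OF E, of m] by (intro sums_mult) simp
  have "(\<lambda>k. x * (c k * m ^ k) + of_nat k * c k * m ^ k) sums
      (x * (1 / x + gamma_tail x m) + m * D)"
    by (rule sums_add[OF xE mD])
  moreover have "x * (c k * m ^ k) + of_nat k * c k * m ^ k = (- m) ^ k /\<^sub>R fact k" for k
  proof -
    have "x * (c k * m ^ k) + of_nat k * c k * m ^ k = (x + of_nat k) * c k * m ^ k"
      by (simp add: algebra_simps)
    also have "(x + of_nat k) * c k = (-1) ^ k / fact k"
      using assms by (simp add: c_def divide_simps add_pos_nonneg)
    finally show ?thesis by (simp add: power_minus[of m] divide_inverse)
  qed
  ultimately have "x * (1 / x + gamma_tail x m) + m * D = exp (- m)"
    using exp_converges[of "- m"] sums_unique2 by auto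
  then have key: "x * (1 / x + gamma_tail x m) = exp (- m) - m * D" by simp
  have pw: "m powr x = m * m powr (x - 1)"
    using assms by (simp add: powr_diff)
  have "((\<lambda>m. m powr x * (1 / x + gamma_tail x m)) has_real_derivative
          (x * m powr (x - 1)) * (1 / x + gamma_tail x m) + D * m powr x) (at m)"
    by (rule DERIV_mult[OF has_real_derivative_powr[OF assms(2)] d])
  also have "(x * m powr (x - 1)) * (1 / x + gamma_tail x m) + D * m powr x =
     m powr (x - 1) * (x * (1 / x + gamma_tail x m)) + D * m powr x" by (simp only: ac_simps)
  also have "\<dots> = exp (- m) * m powr (x - 1)"
    unfolding key pw by (simp add: algebra_simps)
  finally show ?thesis .
qed

lemma continuous_on_gamma_tail_real:
  fixes x :: real
  assumes "x > 0"
  shows "continuous_on UNIV (\<lambda>m. 1 / x + gamma_tail x m)"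
proof -
  have "isCont (\<lambda>m. \<Sum>k. (-1) ^ k / (fact k * (x + of_nat k)) * m ^ k) m" for m :: real
    using termdiffs_strong_converges_everywhere[OF summable_gamma_tail_real[OF assms]]
    by (rule DERIV_isCont)
  then show ?thesis
    unfolding gamma_tail_series[OF assms] by (intro continuous_at_imp_continuous_on) auto
qed

lemma incomplete_gamma_integral:
  fixes x m :: real
  assumes "x > 0" "m \<ge> 0"
  shows "integral {0..m} (\<lambda>t. exp (- t) * t powr (x - 1)) = m powr x * (1 / x + gamma_tail x m)"
proof (rule integral_unique)
  have "((\<lambda>t. exp (- t) * t powr (x - 1)) has_integral
     (m powr x * (1 / x + gamma_tail x m) - 0 powr x * (1 / x + gamma_tail x 0))) {0..m}"
  proof (rule fundamental_theorem_of_calculus_interior[OF assms(2)])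
    show "continuous_on {0..m} (\<lambda>m. m powr x * (1 / x + gamma_tail x m))"
      using assms(1)
      by (intro continuous_on_mult continuous_on_powr'
            continuous_on_subset[OF continuous_on_gamma_tail_real[OF assms(1)]]
            continuous_on_id continuous_on_const) auto
  next
    fix t assume "t \<in> {0<..<m}"
    then show "((\<lambda>m. m powr x * (1 / x + gamma_tail x m)) has_vector_derivative
                 exp (- t) * t powr (x - 1)) (at t)"
      using DERIV_incomplete_gamma[OF assms(1), of t]
      by (simp add: has_real_derivative_iff_has_vector_derivative)
  qed
  then show "((\<lambda>t. exp (- t) * t powr (x - 1)) has_integral
     m powr x * (1 / x + gamma_tail x m)) {0..m}" by simp
qed

text \<open>The incomplete gamma function has a positive derivative, so any positive solution of the defining
  equation is the quantile.\<close>
lemma gamma_quantile_eqI: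
  fixes x m p :: real
  assumes "x > 0" "m > 0" "m powr x * (1 / x + gamma_tail x m) = p * Gamma x"
  shows "gamma_quantile p x = m"
  unfolding gamma_quantile_def
proof (rule the_equality)
  define F where "F m = m powr x * (1 / x + gamma_tail x m)" for m
  have mono: "F a < F b" if "0 < a" "a < b" for a b
  proof (rule DERIV_pos_imp_increasing[OF \<open>a < b\<close>])
    fix t assume "a \<le> t" "t \<le> b"
    then show "\<exists>y. (F has_real_derivative y) (at t) \<and> y > 0"
      using DERIV_incomplete_gamma[OF assms(1), of t] that
      by (intro exI[of _ "exp (- t) * t powr (x - 1)"]) (auto simp: F_def[abs_def])
  qed
  have I: "integral {0..t} (\<lambda>t. exp (- t) * t powr (x - 1)) = F t" if "t > 0" for t
    unfolding F_def using incomplete_gamma_integral[OF assms(1)] that by simp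
  have Fm: "F m = p * Gamma x"
    using assms(3) by (simp add: F_def)
  with I assms(2) show "m > 0 \<and> integral {0..m} (\<lambda>t. exp (- t) * t powr (x - 1)) = p * Gamma x"
    by simp
  fix t assume "t > 0 \<and> integral {0..t} (\<lambda>t. exp (- t) * t powr (x - 1)) = p * Gamma x"
  then have "t > 0" "F t = F m" using I Fm by auto
  then show "t = m"
    using mono[of t m] mono[of m t] assms(2) by (cases t m rule: linorder_cases) auto
qed

section \<open>The logarithm of the correction factor\<close>

text \<open>If \<open>m\<close> is the quantile at a small \<open>x > 0\<close>, this is \<open>ln_Gamma (1 + x) / x\<close> minus the logarithm of the
  scaled quantile.\<close>
definition log_remainder :: "complex \<Rightarrow> complex \<Rightarrow> complex" where
  "log_remainder x m = Ln (1 + x * gamma_tail x m) / x"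

lemma norm_mult_gamma_tail_le:
  assumes "Re x > 0" "norm x \<le> 1/4" "norm m \<le> 1"
  shows "norm (x * gamma_tail x m) \<le> 1/2"
proof -
  have "norm (gamma_tail x m) \<le> 2 * norm m"
    using gamma_tail_lipschitz[of x m 0] assms by simp
  then have "norm x * norm (gamma_tail x m) \<le> 1/4 * 2"
    using assms by (intro mult_mono) auto
  then show ?thesis by (simp add: norm_mult)
qed

lemma one_plus_notin_nonpos_Reals:
  assumes "norm (z :: complex) \<le> 1/2"
  shows "1 + z \<notin> \<real>\<^sub>\<le>\<^sub>0"
proof -
  have "Re (1 + z) > 0"
    using abs_Re_le_cmod[of z] assms by simp
  then show ?thesis using complex_nonpos_Reals_iff by force
qed

lemma Ln_lipschitz:
  assumes "norm (a :: complex) \<le> 1/2" "norm b \<le> 1/2"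
  shows "norm (Ln (1 + a) - Ln (1 + b)) \<le> 2 * norm (a - b)"
proof (rule field_differentiable_bound[of "cball 0 (1/2)" "\<lambda>z. Ln (1 + z)" "\<lambda>z. 1 / (1 + z)"])
  fix z :: complex assume "z \<in> cball 0 (1/2)"
  then have z: "norm z \<le> 1/2" by (simp add: dist_norm)
  show "((\<lambda>z. Ln (1 + z)) has_field_derivative 1 / (1 + z)) (at z within cball 0 (1/2))"
    using one_plus_notin_nonpos_Reals[OF z] by (auto intro!: derivative_eq_intros simp: inverse_eq_divide)
  have "1/2 \<le> norm (1 + z)" using norm_triangle_ineq2[of 1 "- z"] z by simp
  then have "1 / norm (1 + z) \<le> 1 / (1/2)" by (intro divide_left_mono) auto
  then show "norm (1 / (1 + z)) \<le> 2" by (simp add: norm_divide)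
qed (use assms in auto)

text \<open>The factor \<open>x\<close> inside the logarithm cancels the division by \<open>x\<close>, so that the Lipschitz constant in
  \<open>m\<close> does not blow up at \<open>x = 0\<close>.\<close>
lemma log_remainder_lipschitz:
  assumes "Re x > 0" "norm x \<le> 1/4" "norm m \<le> 1" "norm m' \<le> 1"
  shows "norm (log_remainder x m - log_remainder x m') \<le> 4 * norm (m - m')"
proof -
  have x: "norm x > 0" using assms(1) by auto
  have "log_remainder x m - log_remainder x m' =
     (Ln (1 + x * gamma_tail x m) - Ln (1 + x * gamma_tail x m')) / x"
    by (simp add: log_remainder_def diff_divide_distrib)
  then have "norm (log_remainder x m - log_remainder x m') =
     norm (Ln (1 + x * gamma_tail x m) - Ln (1 + x * gamma_tail x m')) / norm x"
    by (simp add: norm_divide)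
  also have "\<dots> \<le> 2 * norm (x * gamma_tail x m - x * gamma_tail x m') / norm x"
    using assms by (intro divide_right_mono Ln_lipschitz norm_mult_gamma_tail_le) auto
  also have "\<dots> = 2 * norm (gamma_tail x m - gamma_tail x m')"
    using x by (simp add: right_diff_distrib[symmetric] norm_mult)
  also have "\<dots> \<le> 4 * norm (m - m')"
    using gamma_tail_lipschitz[of x m m'] assms by simp
  finally show ?thesis .
qed

lemma log_remainder_bound:
  assumes "Re x > 0" "norm x \<le> 1/4" "norm m \<le> 1"
  shows "norm (log_remainder x m) \<le> 4 * norm m"
  using log_remainder_lipschitz[OF assms, of 0] by (simp add: log_remainder_def)

lemma holomorphic_log_remainder:
  assumes "open S" "\<And>x. x \<in> S \<Longrightarrow> Re x > 0" "\<And>x. x \<in> S \<Longrightarrow> norm x \<le> 1/4"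
    and "m holomorphic_on S" "\<And>x. x \<in> S \<Longrightarrow> norm (m x) \<le> 1"
  shows "(\<lambda>x. log_remainder x (m x)) holomorphic_on S"
  unfolding log_remainder_def
proof (intro holomorphic_intros holomorphic_gamma_tail assms)
  show "1 + x * gamma_tail x (m x) \<notin> \<real>\<^sub>\<le>\<^sub>0" if "x \<in> S" for x
    using assms that by (intro one_plus_notin_nonpos_Reals norm_mult_gamma_tail_le) auto
  show "x \<noteq> 0" if "x \<in> S" for x using assms(2)[OF that] by auto
qed

lemma log_remainder_of_real:
  fixes x m :: real
  assumes "0 < x" "x \<le> 1/4" "\<bar>m\<bar> \<le> 1"
  shows "1 + x * gamma_tail x m > 0"
    and "log_remainder (of_real x) (of_real m) = of_real (ln (1 + x * gamma_tail x m) / x)"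
proof -
  have eqc: "of_real x * gamma_tail (complex_of_real x) (of_real m) =
             of_real (x * gamma_tail x m)"
    by (simp add: gamma_tail_of_real[OF assms(1)])
  have "norm (of_real x * gamma_tail (complex_of_real x) (of_real m)) \<le> 1/2"
    using assms by (intro norm_mult_gamma_tail_le) auto
  then have "\<bar>x * gamma_tail x m\<bar> \<le> 1/2"
    unfolding eqc norm_of_real .
  then show pos: "1 + x * gamma_tail x m > 0" by linarith
  show "log_remainder (of_real x) (of_real m) = of_real (ln (1 + x * gamma_tail x m) / x)"
    unfolding log_remainder_def eqc using Ln_of_real[OF pos] by simp
qed

section \<open>Holomorphic dependence of fixed points\<close>

text \<open>A contraction depending holomorphically on a parameter has a holomorphic fixed point: the iterates
  started at \<open>0\<close> are holomorphic and converge at a rate that is the same for all parameters. Since they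
  start at a real number, they stay real wherever the map preserves the reals, and then so does the limit.\<close>
lemma holomorphic_fixed_point:
  fixes T :: "complex \<Rightarrow> complex \<Rightarrow> complex"
  assumes "open S"
    and maps: "\<And>x r. x \<in> S \<Longrightarrow> norm r \<le> 1 \<Longrightarrow> norm (T x r) \<le> 1"
    and contr: "\<And>x r s. x \<in> S \<Longrightarrow> norm r \<le> 1 \<Longrightarrow> norm s \<le> 1 \<Longrightarrow>
                  norm (T x r - T x s) \<le> 1/2 * norm (r - s)"
    and hol: "\<And>r. r holomorphic_on S \<Longrightarrow> (\<And>x. x \<in> S \<Longrightarrow> norm (r x) \<le> 1) \<Longrightarrow>
                  (\<lambda>x. T x (r x)) holomorphic_on S"
  obtains r where "r holomorphic_on S" "\<And>x. x \<in> S \<Longrightarrow> norm (r x) \<le> 1"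
    "\<And>x. x \<in> S \<Longrightarrow> T x (r x) = r x"
    "\<And>x. x \<in> S \<Longrightarrow> (\<And>s. s \<in> \<real> \<Longrightarrow> norm s \<le> 1 \<Longrightarrow> T x s \<in> \<real>) \<Longrightarrow> r x \<in> \<real>"
proof -
  have "\<exists>!r. r \<in> cball 0 1 \<and> T x r = r" if "x \<in> S" for x
    by (rule Banach_fix[where c = "1/2"])
       (use maps[OF that] contr[OF that] in \<open>auto simp: dist_norm compact_imp_complete\<close>)
  then have "\<exists>r. \<forall>x\<in>S. r x \<in> cball 0 1 \<and> T x (r x) = r x"
    by (intro bchoice) blast
  then obtain r where r: "\<And>x. x \<in> S \<Longrightarrow> norm (r x) \<le> 1" "\<And>x. x \<in> S \<Longrightarrow> T x (r x) = r x"
    by (auto simp: dist_norm)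
  define R where "R k x = (T x ^^ k) 0" for k x
  have R_Suc: "R (Suc k) = (\<lambda>x. T x (R k x))" for k by (simp add: R_def fun_eq_iff)
  have R_le: "norm (R k x) \<le> 1" if "x \<in> S" for k x
    by (induction k) (use maps[OF that] in \<open>auto simp: R_Suc R_def\<close>)
  have R_hol: "R k holomorphic_on S" for k
  proof (induction k)
    case (Suc k)
    then show ?case unfolding R_Suc by (intro hol R_le)
  qed (simp add: R_def)
  have R_conv: "norm (R k x - r x) \<le> (1/2) ^ k" if "x \<in> S" for k x
  proof (induction k)
    case 0
    then show ?case using r(1)[OF that] by (simp add: R_def)
  next
    case (Suc k)
    have "norm (R (Suc k) x - r x) = norm (T x (R k x) - T x (r x))"
      using r(2)[OF that] by (simp add: R_Suc)
    also have "\<dots> \<le> 1/2 * norm (R k x - r x)"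
      using that r(1) R_le by (intro contr)
    also have "\<dots> \<le> (1/2) ^ Suc k" using Suc by simp
    finally show ?case .
  qed
  have lim: "uniform_limit S R r sequentially"
  proof (rule uniform_limitI)
    fix e :: real assume "e > 0"
    have "(\<lambda>k. (1/2::real) ^ k) \<longlonglongrightarrow> 0" by (rule LIMSEQ_realpow_zero) auto
    then have "\<forall>\<^sub>F k in sequentially. (1/2) ^ k < e"
      using \<open>e > 0\<close> by (rule order_tendstoD)
    then show "\<forall>\<^sub>F k in sequentially. \<forall>x\<in>S. dist (R k x) (r x) < e"
      by eventually_elim (auto simp: dist_norm intro: le_less_trans[OF R_conv])
  qed
  have "r holomorphic_on S"
  proof (rule holomorphic_uniform_sequence[OF assms(1) R_hol])
    show "\<exists>d>0. cball x d \<subseteq> S \<and> uniform_limit (cball x d) R r sequentially" if "x \<in> S" for x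
      using open_contains_cball_eq[OF assms(1)] that lim by (meson uniform_limit_on_subset)
  qed
  moreover have "r x \<in> \<real>"
    if x: "x \<in> S" and re: "\<And>s. s \<in> \<real> \<Longrightarrow> norm s \<le> 1 \<Longrightarrow> T x s \<in> \<real>" for x
  proof (rule closed_sequentially[OF closed_complex_Reals])
    show "R k x \<in> \<real>" for k
      by (induction k) (use re R_le[OF x] in \<open>auto simp: R_Suc R_def\<close>)
    show "(\<lambda>k. R k x) \<longlonglongrightarrow> r x"
      using lim x by (rule tendsto_uniform_limitI)
  qed
  ultimately show ?thesis using that r by blast
qed

section \<open>Flat functions on a sector\<close>

text \<open>The condition \<open>norm z < 2 * Re z\<close> says that the argument of \<open>z\<close> is less than \<open>pi / 3\<close> in absolute value. It
  keeps \<open>Re (1 / z)\<close> above a fixed multiple of \<open>1 / norm z\<close>.\<close>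
definition sector :: "real \<Rightarrow> complex set" where
  "sector e = {z. norm z < e \<and> norm z < 2 * Re z}"

lemma open_sector: "open (sector e)"
  unfolding sector_def by (intro open_Collect_conj open_Collect_less continuous_intros)

lemma of_real_in_sector: "0 < x \<Longrightarrow> x < e \<Longrightarrow> of_real x \<in> sector e"
  by (simp add: sector_def)

lemma sector_Re_pos: "z \<in> sector e \<Longrightarrow> Re z > 0"
  using norm_ge_zero[of z] unfolding sector_def mem_Collect_eq by linarith

lemma norm_exp_ln_div_sector:
  fixes b :: real
  assumes "z \<in> sector e" "b \<le> 0"
  shows "norm (exp (of_real b / z)) \<le> exp (b / (2 * norm z))"
proof -
  have z: "norm z < 2 * Re z" "norm z > 0"
    using assms sector_Re_pos[OF assms(1)] by (auto simp: sector_def)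
  have "Re (of_real b / z) = b * (Re z / (norm z)\<^sup>2)"
    by (simp add: Re_divide cmod_power2)
  also have "\<dots> \<le> b * (1 / (2 * norm z))"
    using z assms(2) by (intro mult_left_mono_neg) (auto simp: field_simps power2_eq_square)
  finally show ?thesis by simp
qed

text \<open>Cauchy's inequality on the disc of radius \<open>x / 4\<close> around \<open>x\<close>, which lies in the sector and on which
  \<open>norm z < 2 * x\<close>, bounds the \<open>n\<close>-th derivative by a multiple of \<open>exp (- a / (2 * x)) / x ^ n\<close>.\<close>
lemma higher_deriv_flat_on_sector:
  fixes f :: "complex \<Rightarrow> complex"
  assumes "e > 0" "a > 0" "f holomorphic_on sector e"
    and "\<And>z. z \<in> sector e \<Longrightarrow> norm (f z) \<le> K * exp (- a / norm z)"
  shows "((\<lambda>x. (deriv ^^ n) f (complex_of_real x)) \<longlongrightarrow> 0) (at_right 0)"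
proof (rule Lim_null_comparison)
  have K: "K \<ge> 0"
  proof -
    have "norm (f (of_real (e/2))) \<le> K * exp (- a / norm (of_real (e/2) :: complex))"
      using assms(1) by (intro assms(4) of_real_in_sector) auto
    then have "0 \<le> K * exp (- a / norm (of_real (e/2) :: complex))"
      by (rule order_trans[OF norm_ge_zero])
    then show ?thesis by (simp add: zero_le_mult_iff)
  qed
  have "eventually (\<lambda>x::real. x \<in> {0<..<e/2}) (at_right 0)"
    using assms(1) by (intro eventually_at_right_real) auto
  then show "\<forall>\<^sub>F x in at_right 0. norm ((deriv ^^ n) f (complex_of_real x)) \<le>
     fact n * (K * exp (- a / (2 * x))) / (x / 4) ^ n"
  proof eventually_elim
    case (elim x)
    have sub: "norm z < 2 * x \<and> z \<in> sector e" if "z \<in> cball (of_real x) (x / 4)" for z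
    proof -
      have d: "norm (z - of_real x) \<le> x / 4" using that by (simp add: dist_norm norm_minus_commute)
      have "norm z \<le> 5 / 4 * x"
        using norm_triangle_ineq[of "z - of_real x" "of_real x"] d elim by simp
      moreover have "Re z \<ge> 3 / 4 * x"
        using abs_Re_le_cmod[of "z - of_real x"] d by (simp add: abs_le_iff)
      ultimately show ?thesis using elim by (auto simp: sector_def)
    qed
    show ?case
    proof (rule Cauchy_inequality)
      show "f holomorphic_on ball (complex_of_real x) (x / 4)"
        using sub by (intro holomorphic_on_subset[OF assms(3)]) auto
      show "continuous_on (cball (complex_of_real x) (x / 4)) f"
        using sub by (intro holomorphic_on_imp_continuous_on holomorphic_on_subset[OF assms(3)]) auto
      show "0 < x / 4" using elim by simp
      fix z assume "norm (complex_of_real x - z) = x / 4"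
      then have z: "norm z < 2 * x" "z \<in> sector e"
        using sub[of z] by (auto simp: dist_norm)
      have "norm (f z) \<le> K * exp (- a / norm z)" by (rule assms(4)[OF z(2)])
      moreover have "a / (2 * x) \<le> a / norm z"
        using z(1) sector_Re_pos[OF z(2)] assms(2) elim
        by (intro divide_left_mono mult_pos_pos) auto
      then have "K * exp (- a / norm z) \<le> K * exp (- a / (2 * x))"
        using K by (intro mult_left_mono) auto
      ultimately show "norm (f z) \<le> K * exp (- a / (2 * x))" by linarith
    qed
  qed
  show "((\<lambda>x. fact n * (K * exp (- a / (2 * x))) / (x / 4) ^ n) \<longlongrightarrow> 0) (at_right (0::real))"
    using assms(2) by real_asymp
qed

lemma higher_deriv_Re_of_real:
  fixes g :: "real \<Rightarrow> real"
  assumes "open S" "f holomorphic_on S"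
    and "\<And>x. 0 < x \<Longrightarrow> x < e \<Longrightarrow> complex_of_real x \<in> S \<and> g x = Re (f (of_real x))"
    and "0 < x" "x < e"
  shows "(deriv ^^ n) g x = Re ((deriv ^^ n) f (of_real x))"
  using assms(4,5)
proof (induction n arbitrary: x)
  case 0
  then show ?case using assms(3) by simp
next
  case (Suc n)
  have "((deriv ^^ n) f has_field_derivative (deriv ^^ Suc n) f (of_real x)) (at (of_real x))"
    using assms Suc.prems by (intro has_field_derivative_higher_deriv[of _ S]) auto
  then have "((\<lambda>x. Re ((deriv ^^ n) f (of_real x))) has_real_derivative
       Re ((deriv ^^ Suc n) f (of_real x))) (at x)"
    by (rule has_field_derivative_Re[OF has_vector_derivative_real_field])
  then have "((deriv ^^ n) g has_real_derivative Re ((deriv ^^ Suc n) f (of_real x))) (at x)"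
    by (rule has_field_derivative_transform_within_open[of _ _ _ "{0<..<e}"])
       (use Suc in auto)
  then show ?case by (simp add: DERIV_imp_deriv)
qed

section \<open>The quantile as a holomorphic fixed point\<close>

text \<open>Since \<open>ln_Gamma 1 = 0\<close>, the quotient \<open>ln_Gamma (1 + z) / z\<close> has a removable singularity at \<open>0\<close>.\<close>
lemma ln_Gamma_divided_by_id:
  obtains \<phi> where "\<phi> holomorphic_on ball 0 1"
    "\<And>z. z \<in> ball 0 1 \<Longrightarrow> ln_Gamma (1 + z) = z * \<phi> z"
proof
  define \<phi> where "\<phi> = (\<lambda>z::complex. if z = 0 then deriv (\<lambda>z. ln_Gamma (1 + z)) 0
                       else (ln_Gamma (1 + z) - ln_Gamma (1 + 0)) / (z - 0))"
  have "w \<notin> \<real>\<^sub>\<le>\<^sub>0" if "dist 1 w < 1" for w :: complex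
    using abs_Re_le_cmod[of "1 - w"] that by (auto simp: dist_norm complex_nonpos_Reals_iff)
  then have "(\<lambda>z. ln_Gamma (1 + z :: complex)) holomorphic_on ball 0 1"
    by (intro holomorphic_on_compose[of "\<lambda>z. 1 + z" _ ln_Gamma, unfolded o_def]
         holomorphic_ln_Gamma holomorphic_intros) auto
  then show "\<phi> holomorphic_on ball 0 1"
    unfolding \<phi>_def by (rule pole_lemma_open) auto
  have "ln_Gamma (1 :: complex) = 0"
    using ln_Gamma_complex_of_real[of 1] by (simp add: ln_Gamma_real_pos)
  then show "ln_Gamma (1 + z) = z * \<phi> z" if "z \<in> ball 0 1" for z
    by (simp add: \<phi>_def)
qed

lemma norm_exp_unit:
  assumes "norm (r :: complex) \<le> 1"
  shows "norm (exp r) \<le> 3"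
proof -
  have "Re r \<le> 1" using complex_Re_le_cmod[of r] assms by linarith
  then have "exp (Re r) \<le> exp 1" by simp
  also have "\<dots> \<le> 3" by (rule exp_le)
  finally show ?thesis by simp
qed

lemma exp_lipschitz_unit:
  assumes "norm (r :: complex) \<le> 1" "norm s \<le> 1"
  shows "norm (exp r - exp s) \<le> 3 * norm (r - s)"
  by (rule field_differentiable_bound[of "cball 0 1" exp exp])
     (use assms norm_exp_unit in \<open>auto intro: DERIV_subset[OF DERIV_exp]\<close>)

text \<open>The fixed point equation, multiplied by \<open>x\<close> and exponentiated, is the defining equation of the
  quantile.\<close>
lemma gamma_quantile_of_log_correction:
  fixes x p m \<rho> :: real
  assumes "0 < x" "x \<le> 1/4" "0 < p" "0 < m" "m \<le> 1"
    and m: "m = exp ((ln p + ln_Gamma (1 + x)) / x + \<rho>)"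
    and \<rho>: "of_real \<rho> = - log_remainder (of_real x) (of_real m)"
  shows "gamma_quantile p x = m"
proof (rule gamma_quantile_eqI)
  note lr = log_remainder_of_real[of x m]
  have pos: "1 + x * gamma_tail x m > 0"
    using lr(1) assms(1,2,4,5) by simp
  have "complex_of_real \<rho> = of_real (- ln (1 + x * gamma_tail x m) / x)"
    unfolding \<rho> using lr(2) assms(1,2,4,5) by simp
  then have "\<rho> = - ln (1 + x * gamma_tail x m) / x"
    unfolding of_real_eq_iff .
  then have "x * \<rho> = - ln (1 + x * gamma_tail x m)"
    using assms(1) by simp
  moreover have "ln m = (ln p + ln_Gamma (1 + x)) / x + \<rho>"
    by (subst m) (rule ln_exp)
  then have "x * ln m = ln p + ln_Gamma (1 + x) + x * \<rho>"
    using assms(1) by (simp add: distrib_left[of x _ \<rho>])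
  ultimately have "x * ln m = ln p + ln_Gamma (1 + x) - ln (1 + x * gamma_tail x m)"
    by simp
  then have "m powr x = exp (ln p + ln_Gamma (1 + x) - ln (1 + x * gamma_tail x m))"
    using assms(4) by (simp add: powr_def)
  also have "\<dots> = p * Gamma (1 + x) / (1 + x * gamma_tail x m)"
    using assms(1,3) pos by (simp add: exp_diff exp_add Gamma_real_pos_exp)
  also have "Gamma (1 + x) = x * Gamma x"
    using Gamma_plus1[of x] assms(1) nonpos_Ints_nonpos[of x] by (auto simp: add.commute)
  finally have "m powr x * (1 + x * gamma_tail x m) = p * (x * Gamma x)"
    using pos by (simp add: field_simps)
  then show "m powr x * (1 / x + gamma_tail x m) = p * Gamma x"
    using assms(1) by (simp add: field_simps)
qed (use assms in auto)

text \<open>The contraction argument. With \<open>Q z = exp (ln p / z + \<phi> z)\<close>, the candidate quantile is \<open>Q z * exp r\<close>, and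
  the correction \<open>r\<close> is the fixed point of \<open>T z r = - log_remainder z (Q z * exp r)\<close>. The function \<open>\<phi>\<close> is
  a parameter so that it can be fixed before \<open>p\<close>.\<close>
lemma scaled_quantile_holomorphic_extension:
  fixes p :: real and \<phi> :: "complex \<Rightarrow> complex"
  assumes p: "0 < p" "p < 1"
    and \<phi>: "\<phi> holomorphic_on ball 0 1"
      "\<And>z. z \<in> ball 0 1 \<Longrightarrow> ln_Gamma (1 + z) = z * \<phi> z"
  obtains e a K r where "0 < e" "e \<le> 1" "0 < a" "r holomorphic_on sector e"
    "\<And>z. z \<in> sector e \<Longrightarrow> norm (exp (\<phi> z + r z) - exp (\<phi> z)) \<le> K * exp (- a / norm z)"
    "\<And>x. 0 < x \<Longrightarrow> x < e \<Longrightarrow> scaled_quantile p x = Re (exp (\<phi> (of_real x) + r (of_real x)))"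
proof -
  define c where "c = - ln p"
  have c: "c > 0" using p by (simp add: c_def)
  have "bounded (\<phi> ` cball 0 (1/2))"
    by (intro compact_imp_bounded compact_continuous_image holomorphic_on_imp_continuous_on
          holomorphic_on_subset[OF \<phi>(1)]) auto
  then obtain B where B: "B > 0" "\<And>z. norm z \<le> 1/2 \<Longrightarrow> norm (\<phi> z) \<le> B"
    unfolding bounded_pos by auto
  \<comment> \<open>\<open>T z\<close> has Lipschitz constant \<open>4 * norm (Q z) * 3\<close>, so \<open>norm (Q z) \<le> 1/24\<close> makes it \<open>1/2\<close>.
    This bound follows from \<open>exp (- 24) \<le> 1/24\<close> once \<open>B - c / (2 * norm z) \<le> - 24\<close>, whence the
    second term of the minimum.\<close>
  define e where "e = min (1/4) (c / (2 * (B + 24)))"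
  have e: "e > 0" "e \<le> 1/4" "e \<le> c / (2 * (B + 24))"
    using c B(1) unfolding e_def by (simp, intro min.cobounded1, intro min.cobounded2)
  define Q where "Q z = exp (of_real (ln p) / z + \<phi> z)" for z :: complex
  have inS: "Re z > 0 \<and> norm z < 1/4 \<and> norm z < e \<and> norm z > 0" if "z \<in> sector e" for z
    using that e(2) sector_Re_pos[OF that] by (auto simp: sector_def)
  have exp_phi: "norm (exp (\<phi> z)) \<le> exp B" if "z \<in> sector e" for z
  proof -
    have "Re (\<phi> z) \<le> B"
      using complex_Re_le_cmod[of "\<phi> z"] B(2)[of z] inS[OF that] by simp
    then show ?thesis by simp
  qed
  have Q_flat: "norm (Q z) \<le> exp B * exp (- (c / 2) / norm z)" if "z \<in> sector e" for z
  proof -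
    have "norm (exp (of_real (ln p) / z)) \<le> exp (ln p / (2 * norm z))"
      using that p by (intro norm_exp_ln_div_sector) auto
    then have "norm (exp (of_real (ln p) / z)) * norm (exp (\<phi> z)) \<le>
               exp (ln p / (2 * norm z)) * exp B"
      using exp_phi[OF that] by (intro mult_mono) auto
    then show ?thesis
      unfolding Q_def exp_add norm_mult by (simp add: c_def mult.commute)
  qed
  have Q_small: "norm (Q z) \<le> 1/24" if "z \<in> sector e" for z
  proof -
    have "norm z * (2 * (B + 24)) \<le> e * (2 * (B + 24))"
      using inS[OF that] B(1) by (intro mult_right_mono) auto
    also have "\<dots> \<le> c"
      using e(3) B(1) by (simp add: field_simps)
    finally have "norm z * (2 * (B + 24)) \<le> c" .
    then have "B + - (c / 2) / norm z \<le> - 24"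
      using inS[OF that] by (simp add: field_simps)
    then have "exp B * exp (- (c / 2) / norm z) \<le> exp (- 24)"
      unfolding exp_add[symmetric] by simp
    also have "\<dots> \<le> 1 / 24"
      using exp_ge_add_one_self[of 24] by (simp add: exp_minus field_simps)
    finally show ?thesis using Q_flat[OF that] by linarith
  qed
  have Q_hol: "Q holomorphic_on sector e"
    unfolding Q_def using inS by (intro holomorphic_intros holomorphic_on_subset[OF \<phi>(1)]) force+
  have m_le: "norm (Q z * exp r) \<le> 3 * norm (Q z)" if "norm r \<le> 1" for z r
    using mult_left_mono[OF norm_exp_unit[OF that], of "norm (Q z)"] by (simp add: norm_mult)
  define T where "T z r = - log_remainder z (Q z * exp r)" for z r
  have m_le_1: "norm (Q z * exp r) \<le> 1" if "z \<in> sector e" "norm r \<le> 1" for z r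
    using m_le[OF that(2), of z] Q_small[OF that(1)] by linarith
  have T_le: "norm (T z r) \<le> 12 * norm (Q z)" if "z \<in> sector e" "norm r \<le> 1" for z r
    using log_remainder_bound[of z "Q z * exp r"] inS[OF that(1)] m_le_1[OF that] m_le[OF that(2), of z]
    by (simp add: T_def)
  have T_lip: "norm (T z r - T z s) \<le> 1/2 * norm (r - s)"
    if "z \<in> sector e" "norm r \<le> 1" "norm s \<le> 1" for z r s
  proof -
    have "norm (T z r - T z s) \<le> 4 * norm (Q z * exp r - Q z * exp s)"
      using log_remainder_lipschitz[of z "Q z * exp r" "Q z * exp s"] inS[OF that(1)] m_le_1 that
      by (simp add: T_def norm_minus_commute)
    also have "\<dots> = 4 * norm (Q z) * norm (exp r - exp s)"
      by (simp add: right_diff_distrib[symmetric] norm_mult)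
    also have "\<dots> \<le> 4 * (1/24) * (3 * norm (r - s))"
      using Q_small[OF that(1)] exp_lipschitz_unit[OF that(2,3)] by (intro mult_mono) auto
    finally show ?thesis by simp
  qed
  obtain r where r: "r holomorphic_on sector e" "\<And>z. z \<in> sector e \<Longrightarrow> norm (r z) \<le> 1"
    "\<And>z. z \<in> sector e \<Longrightarrow> T z (r z) = r z"
    "\<And>z. z \<in> sector e \<Longrightarrow> (\<And>s. s \<in> \<real> \<Longrightarrow> norm s \<le> 1 \<Longrightarrow> T z s \<in> \<real>) \<Longrightarrow> r z \<in> \<real>"
  proof (rule holomorphic_fixed_point[OF open_sector, of e T])
    show "norm (T z s) \<le> 1" if "z \<in> sector e" "norm s \<le> 1" for z s
      using T_le[OF that] Q_small[OF that(1)] by linarith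
    show "(\<lambda>z. T z (s z)) holomorphic_on sector e"
      if "s holomorphic_on sector e" "\<And>z. z \<in> sector e \<Longrightarrow> norm (s z) \<le> 1" for s
      unfolding T_def using inS m_le_1 that
      by (intro holomorphic_intros holomorphic_log_remainder open_sector Q_hol) (auto intro: less_imp_le)
  qed (use T_lip in auto)
  show ?thesis
  proof
    show "0 < e" "e \<le> 1" "0 < c / 2" "r holomorphic_on sector e" using e c r(1) by auto
    show "norm (exp (\<phi> z + r z) - exp (\<phi> z)) \<le> (36 * exp B * exp B) * exp (- (c / 2) / norm z)"
      if z: "z \<in> sector e" for z
    proof -
      have "norm (exp (r z) - exp 0) \<le> 3 * norm (r z - 0)"
        by (intro exp_lipschitz_unit r(2)[OF z]) auto
      moreover have "norm (r z) \<le> 12 * norm (Q z)"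
        using T_le[OF z r(2)[OF z]] r(3)[OF z] by simp
      ultimately have "norm (exp (r z) - 1) \<le> 36 * (exp B * exp (- (c / 2) / norm z))"
        using Q_flat[OF z] by simp
      then have "norm (exp (\<phi> z)) * norm (exp (r z) - 1) \<le>
         exp B * (36 * (exp B * exp (- (c / 2) / norm z)))"
        using exp_phi[OF z] by (intro mult_mono) auto
      moreover have "exp (\<phi> z + r z) - exp (\<phi> z) = exp (\<phi> z) * (exp (r z) - 1)"
        by (simp add: exp_add algebra_simps)
      ultimately show ?thesis by (simp add: norm_mult ac_simps)
    qed
    fix x :: real assume x: "0 < x" "x < e"
    let ?x = "complex_of_real x"
    have xS: "?x \<in> sector e" using x by (rule of_real_in_sector)
    define q where "q = (ln p + ln_Gamma (1 + x)) / x"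
    have "ln_Gamma (1 + ?x) = ?x * \<phi> ?x"
      using x e(2) by (intro \<phi>(2)) auto
    then have "\<phi> ?x = of_real (ln_Gamma (1 + x) / x)"
      using x ln_Gamma_complex_of_real[of "1 + x"] by (simp add: field_simps)
    then have phi_x: "\<phi> ?x = of_real (q - ln p / x)"
      by (simp add: q_def add_divide_distrib)
    then have Q_x: "Q ?x = of_real (exp q)"
      by (simp add: Q_def exp_of_real[symmetric])
    have "r ?x \<in> \<real>"
    proof (rule r(4)[OF xS])
      fix s :: complex assume s: "s \<in> \<real>" "norm s \<le> 1"
      then obtain t where t: "s = of_real t" by (auto elim: Reals_cases)
      let ?m = "exp q * exp t"
      have m: "Q ?x * exp s = of_real ?m" by (simp add: Q_x t exp_of_real)
      have "\<bar>?m\<bar> \<le> 1"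
        using m_le_1[OF xS s(2)] unfolding m norm_of_real .
      then show "T ?x s \<in> \<real>"
        using log_remainder_of_real(2)[of x ?m] x e(2) unfolding T_def m by simp
    qed
    then obtain \<rho> where rho: "r ?x = of_real \<rho>" by (auto elim: Reals_cases)
    have m: "Q ?x * exp (r ?x) = of_real (exp (q + \<rho>))"
      by (simp add: Q_x rho exp_of_real exp_add)
    have "gamma_quantile p x = exp (q + \<rho>)"
    proof (rule gamma_quantile_of_log_correction)
      show "exp (q + \<rho>) \<le> 1"
        using m_le_1[OF xS r(2)[OF xS]] unfolding m norm_of_real by simp
      show "of_real \<rho> = - log_remainder ?x (of_real (exp (q + \<rho>)))"
        using r(3)[OF xS] unfolding T_def m by (simp only: rho)
    qed (use x e p in \<open>auto simp: q_def\<close>)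
    then have "scaled_quantile p x = exp (q - ln p / x + \<rho>)"
      by (simp add: scaled_quantile_def exp_add[symmetric])
    also have "of_real \<dots> = exp (\<phi> ?x + r ?x)"
      unfolding phi_x rho by (simp only: exp_of_real[symmetric] of_real_add)
    then have "exp (q - ln p / x + \<rho>) = Re (exp (\<phi> ?x + r ?x))"
      by (metis Re_complex_of_real)
    finally show "scaled_quantile p x = Re (exp (\<phi> ?x + r ?x))" .
  qed
qed

section \<open>The limits of the derivatives\<close>

theorem proposition2p4:
  fixes n :: nat
  shows "\<exists>L::real. \<forall>p::real. 0 < p \<and> p < 1 \<longrightarrow>
           (((deriv ^^ n) (scaled_quantile p)) \<longlongrightarrow> L) (at_right 0)"
proof -
  obtain \<phi> where \<phi>: "\<phi> holomorphic_on ball 0 1"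
    "\<And>z. z \<in> ball 0 1 \<Longrightarrow> ln_Gamma (1 + z) = z * \<phi> z"
    using ln_Gamma_divided_by_id by blast
  define E where "E z = exp (\<phi> z)" for z
  have E: "E holomorphic_on ball 0 1"
    unfolding E_def by (intro holomorphic_intros \<phi>)
  have "isCont ((deriv ^^ n) E) 0"
    using holomorphic_on_imp_continuous_on[OF holomorphic_higher_deriv[OF E open_ball]]
    by (rule continuous_on_interior) (simp add: interior_open)
  moreover have "((\<lambda>x. complex_of_real x) \<longlongrightarrow> 0) (at_right 0)"
    using tendsto_of_real[OF tendsto_ident_at, of 0 "{0<..}", where 'a = complex] by simp
  ultimately have E_lim: "((\<lambda>x. (deriv ^^ n) E (complex_of_real x)) \<longlongrightarrow> (deriv ^^ n) E 0) (at_right 0)"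
    by (rule isCont_tendsto_compose)
  have "((deriv ^^ n) (scaled_quantile p) \<longlongrightarrow> Re ((deriv ^^ n) E 0)) (at_right 0)"
    if p: "0 < p" "p < 1" for p
  proof -
    obtain e a K r where e: "0 < e" "e \<le> 1" and a: "0 < a" and r: "r holomorphic_on sector e"
      and flat: "\<And>z. z \<in> sector e \<Longrightarrow> norm (exp (\<phi> z + r z) - exp (\<phi> z)) \<le> K * exp (- a / norm z)"
      and u: "\<And>x. 0 < x \<Longrightarrow> x < e \<Longrightarrow> scaled_quantile p x = Re (exp (\<phi> (of_real x) + r (of_real x)))"
      using scaled_quantile_holomorphic_extension[OF p \<phi>] by metis
    define U where "U z = exp (\<phi> z + r z)" for z
    have "sector e \<subseteq> ball 0 1" using e by (auto simp: sector_def)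
    then have hol: "E holomorphic_on sector e" "U holomorphic_on sector e"
      unfolding U_def using E \<phi>(1) r
      by (auto intro!: holomorphic_intros intro: holomorphic_on_subset)
    have "((\<lambda>x. (deriv ^^ n) (\<lambda>z. U z - E z) (complex_of_real x)) \<longlongrightarrow> 0) (at_right 0)"
      using e(1) a holomorphic_on_diff[OF hol(2,1)]
      by (rule higher_deriv_flat_on_sector) (use flat in \<open>simp add: U_def E_def\<close>)
    from tendsto_Re[OF tendsto_add[OF this E_lim]]
    have "((\<lambda>x. Re ((deriv ^^ n) (\<lambda>z. U z - E z) (of_real x) + (deriv ^^ n) E (of_real x)))
            \<longlongrightarrow> Re ((deriv ^^ n) E 0)) (at_right 0)" by simp
    moreover have "\<forall>\<^sub>F x in at_right 0.
        Re ((deriv ^^ n) (\<lambda>z. U z - E z) (of_real x) + (deriv ^^ n) E (of_real x)) =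
        (deriv ^^ n) (scaled_quantile p) x"
      using eventually_at_right_real[OF e(1)]
    proof eventually_elim
      case (elim x)
      then have x: "0 < x" "x < e" by auto
      have "(deriv ^^ n) (scaled_quantile p) x = Re ((deriv ^^ n) U (of_real x))"
        using open_sector hol(2) _ x
        by (rule higher_deriv_Re_of_real) (use u of_real_in_sector in \<open>auto simp: U_def\<close>)
      then show ?case
        using higher_deriv_diff[OF hol(2,1) open_sector of_real_in_sector[OF x], of n] by simp
    qed
    ultimately show ?thesis by (rule Lim_transform_eventually)
  qed
  then show ?thesis by blast
qed

end
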